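(* Let $G$ be a finite abelian group having at least one proper non-trivial subgroup. Then: (1) $\gamma(G)=1$ if and only if $\mathrm{sfp}(G)<\mathrm{exp}(G)$. (2) $\gamma(G)=2$ if and only if $\mathrm{sfp}(G)=\mathrm{exp}(G)$ and $\mathrm{sfp}(G)$ is not a prime number. (3) For a prime number $p$: $\gamma(G)=p+1$ if and only if $p=\mathrm{sfp}(G)=\mathrm{exp}(G)$.
   Context: For a group $G$, $V(G)$ denotes the set of all proper non-trivial subgroups of $G$. The intersection graph $\Gamma(G)$ is the simple undirected graph with vertex set $V(G)$ in which two distinct vertices $H,K$ are adjacent if and only if $H\cap K\neq 1$. A dominating set of a graph is a subset $D$ of its vertex set such that every vertex not in $D$ is adjacent to some vertex in $D$. The domination number $\gamma(G)$ is the smallest cardinality of a dominating set of $\Gamma(G)$. For a finite group $G$, $\mathrm{exp}(G)$ is the exponent of $G$ (the least common multiple of the orders of its elements), and $\mathrm{sfp}(G)$ is the product of the distinct primes dividing $|G|$. *)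

theory Defs
  imports
    "HOL-Algebra.Multiplicative_Group"
    "HOL-Computational_Algebra.Primes"
    "Graph_Theory.Pair_Digraph"
begin

definition proper_nontrivial_subgroups :: "('a, 'b) monoid_scheme \<Rightarrow> 'a set set" where
  "proper_nontrivial_subgroups G =
     {H. subgroup H G \<and> H \<noteq> carrier G \<and> H \<noteq> {\<one>\<^bsub>G\<^esub>}}"

(* As usual in Graph_Theory, an undirected edge is a pair of opposite arcs. *)
definition intersection_graph :: "('a, 'b) monoid_scheme \<Rightarrow> 'a set pair_pre_digraph" where
  "intersection_graph G =
     \<lparr> pverts = proper_nontrivial_subgroups G,
       parcs = {(H, K). H \<in> proper_nontrivial_subgroups G \<and> K \<in> proper_nontrivial_subgroups G
                        \<and> H \<noteq> K \<and> H \<inter> K \<noteq> {\<one>\<^bsub>G\<^esub>}} \<rparr>"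

lemma pair_graph_intersection_graph:
  assumes "finite (carrier G)"
  shows "pair_graph (intersection_graph G)"
proof -
  have "proper_nontrivial_subgroups G \<subseteq> Pow (carrier G)"
    unfolding proper_nontrivial_subgroups_def by (auto dest: subgroup.subset)
  then have fin: "finite (proper_nontrivial_subgroups G)"
    using assms by (simp add: finite_subset)
  then have "finite (parcs (intersection_graph G))"
    by (auto simp: intersection_graph_def
        intro: finite_subset[of _ "proper_nontrivial_subgroups G \<times> proper_nontrivial_subgroups G"])
  with fin show ?thesis
    by unfold_locales
      (auto simp: intersection_graph_def symmetric_def sym_def arcs_ends_conv with_proj_def)
qed

(* The arc relation of a digraph is called "dominates" in Graph_Theory; here it is adjacency. *)
definition dominating_set :: "('a, 'b) pre_digraph \<Rightarrow> 'a set \<Rightarrow> bool" where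
  "dominating_set \<Gamma> D \<longleftrightarrow> D \<subseteq> verts \<Gamma> \<and> (\<forall>v \<in> verts \<Gamma> - D. \<exists>u \<in> D. v \<rightarrow>\<^bsub>\<Gamma>\<^esub> u)"

(* Only meaningful for graphs with a finite dominating set, e.g. for every finite graph. *)
definition domination_number :: "('a, 'b) pre_digraph \<Rightarrow> nat" where
  "domination_number \<Gamma> = (LEAST n. \<exists>D. dominating_set \<Gamma> D \<and> finite D \<and> card D = n)"

definition group_domination_number :: "('a, 'b) monoid_scheme \<Rightarrow> nat" where
  "group_domination_number G = domination_number (with_proj (intersection_graph G))"

definition group_exponent :: "('a, 'b) monoid_scheme \<Rightarrow> nat" where
  "group_exponent G = Lcm (group.ord G ` carrier G)"

definition sfp :: "('a, 'b) monoid_scheme \<Rightarrow> nat" where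
  "sfp G = \<Prod> {p. prime p \<and> p dvd order G}"

end

theory Submission
  imports Defs "HOL-Algebra.Sylow" "HOL-Computational_Algebra.Squarefree" "HOL-Number_Theory.Cong"
begin

text \<open>
  The argument rests on a reformulation (\<open>dominating_set_iff_covers_prime_order\<close>): a set \<open>D\<close> of
  proper nontrivial subgroups is dominating iff its members together contain every element of
  prime order. Indeed, such an element \<open>x\<close> generates a minimal subgroup, which can be equal to or
  meet a member of \<open>D\<close> only if that member contains \<open>x\<close>; conversely, every nontrivial subgroup
  contains an element of prime order. So \<open>\<gamma>(G)\<close> is the least number of proper subgroups needed to
  cover the elements of prime order.

  By Cauchy's theorem, \<open>sfp(G)\<close> divides \<open>exp(G)\<close>, which leaves three mutually exclusive cases; it
  suffices to compute \<open>\<gamma>(G)\<close> in each, since the values \<open>1\<close>, \<open>2\<close> and \<open>p + 1 \<ge> 3\<close> differ. Write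
  \<open>G[n]\<close> for the subgroup of all \<open>x\<close> with \<open>x\<^sup>n = 1\<close>.

  If \<open>sfp(G) < exp(G)\<close>, then \<open>G[sfp(G)]\<close> is proper and contains all elements of prime order.

  If \<open>sfp(G) = exp(G) = p m\<close> with \<open>p\<close> prime and \<open>m > 1\<close>, every prime divisor of \<open>|G|\<close> is \<open>p\<close> or
  divides \<open>m\<close>, so \<open>G[p]\<close> and \<open>G[m]\<close> suffice. One proper subgroup does not: the orders of all
  elements are square-free, hence every element is a product of elements of prime order
  (\<open>mem_subgroup_if_squarefree_order\<close>).

  If \<open>sfp(G) = exp(G) = p\<close>, then \<open>G\<close> is a vector space over the field with \<open>p\<close> elements, of
  dimension at least two, and \<open>\<gamma>(G)\<close> is the least number of proper subspaces covering it. The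
  \<open>p + 1\<close> hyperplanes through a subspace of codimension two form such a cover
  (\<open>elementary_abelian_cover\<close>). Fewer do not suffice, because a proper subspace has at most
  \<open>|G| / p\<close> elements and all of them share the zero vector (\<open>card_subgroup_cover_gt\<close>).
\<close>

section \<open>Arithmetic of products of distinct primes\<close>

lemma prod_distinct_primes_dvd:
  fixes S :: "nat set"
  assumes "finite S" "\<And>p. p \<in> S \<Longrightarrow> prime p" "\<And>p. p \<in> S \<Longrightarrow> p dvd n"
  shows "\<Prod>S dvd n"
  using assms
proof (induction S rule: finite_induct)
  case (insert p S)
  have "coprime p (\<Prod>S)"
  proof (rule prod_coprime_right)
    fix q assume "q \<in> S"
    with insert.hyps(2) insert.prems(1) show "coprime p q"
      by (intro primes_coprime) auto
  qed
  then have "p * \<Prod>S dvd n"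
    using insert by (intro divides_mult) auto
  with insert.hyps show ?case by simp
qed simp

lemma squarefree_prod_distinct_primes:
  fixes S :: "nat set"
  assumes "\<And>p. p \<in> S \<Longrightarrow> prime p"
  shows "squarefree (\<Prod>S)"
  using assms by (intro squarefree_prod_coprime) (auto intro: primes_coprime squarefree_prime)

lemma prime_power_if_unique_prime_divisor:
  fixes n p :: nat
  assumes "n \<noteq> 0" "prime p" "\<And>q. prime q \<Longrightarrow> q dvd n \<Longrightarrow> q = p"
  obtains k where "n = p ^ k"
proof -
  obtain m where m: "n = p ^ multiplicity p n * m" "\<not> p dvd m"
    using multiplicity_decompose'[of n p] assms(1,2) by (metis not_prime_unit)
  \<comment> \<open>A prime divisor of \<open>m\<close> would be \<open>p\<close>, which has been split off completely.\<close>
  have "m = 1"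
    using assms(3) m by (metis dvd_mult prime_factor_nat)
  with m(1) that show thesis by (metis mult.right_neutral)
qed

section \<open>Elements of prime order in a finite group\<close>

context group
begin

lemma card_subgroup_dvd:
  assumes "subgroup H G" "subgroup K G" "H \<subseteq> K"
  shows "card H dvd card K"
proof -
  interpret K: group "G\<lparr>carrier := K\<rparr>"
    using assms(2) by (rule subgroup_imp_group)
  show ?thesis
    using K.lagrange[OF subgroup_incl[OF assms]] by (auto simp: order_def dest: sym)
qed

lemma ord_dvd_card_subgroup:
  assumes "subgroup H G" "x \<in> H"
  shows "ord x dvd card H"
proof -
  have "x \<in> carrier G" using assms subgroup.subset by blast
  moreover have "generate G {x} \<subseteq> H"
    using assms by (intro generate_subgroup_incl) auto
  ultimately show ?thesis
    using card_subgroup_dvd[OF generate_is_subgroup[of "{x}"] assms(1)] generate_pow_card by simp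
qed

lemma nat_pow_mem_subgroup:
  assumes "subgroup H G" "x \<in> H"
  shows "x [^] (n::nat) \<in> H"
  using subgroup_int_pow_closed[OF assms, of "int n"] by (simp add: int_pow_int)

lemma pow_cong:
  assumes "x \<in> carrier G" "x [^] p = \<one>" "[m = n] (mod p)"
  shows "x [^] (m::nat) = x [^] n"
proof -
  have red: "x [^] k = x [^] (k mod p)" for k :: nat
  proof -
    have "x [^] k = x [^] (p * (k div p) + k mod p)" by simp
    also have "\<dots> = x [^] (k mod p)"
      using assms(1,2) by (simp only: nat_pow_mult[symmetric] nat_pow_pow[symmetric]) simp
    finally show ?thesis .
  qed
  show ?thesis using assms(3) red[of m] red[of n] by (simp add: cong_def)
qed

lemma obtain_prime_order_element:
  assumes "finite (carrier G)" "subgroup H G" "H \<noteq> {\<one>}"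
  obtains x where "x \<in> H" "prime (ord x)"
proof -
  obtain y where y: "y \<in> H" "y \<noteq> \<one>"
    using assms(2,3) subgroup.one_closed by blast
  then have yG: "y \<in> carrier G" using assms(2) subgroup.subset by blast
  have "ord y \<noteq> 1" using y(2) yG ord_eq_1 by blast
  then obtain q where q: "prime q" "q dvd ord y" using prime_factor_nat by blast
  then obtain m where m: "ord y = q * m" by blast
  have "ord y \<ge> 1" using ord_ge_1[OF assms(1) yG] .
  with m have "m \<noteq> 0" "m dvd ord y" by auto
  then have "ord (y [^] m) = q" using ord_pow[OF yG] m by simp
  with q(1) that[of "y [^] m"] nat_pow_mem_subgroup[OF assms(2) y(1)] show thesis by simp
qed

text \<open>Cauchy's theorem: a Sylow argument yields a subgroup of order \<open>p\<close>, and any nontrivial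
  element of it has order \<open>p\<close>.\<close>

lemma Cauchy:
  assumes "finite (carrier G)" "prime p" "p dvd order G"
  obtains x where "x \<in> carrier G" "ord x = p"
proof -
  obtain m where "order G = p ^ 1 * m" using assms(3) by auto
  then obtain H where H: "subgroup H G" "card H = p"
    using sylow_thm[OF assms(2) is_group _ assms(1), of 1 m] by auto
  have "H \<noteq> {\<one>}" using H(2) assms(2) by auto
  then obtain x where x: "x \<in> H" "prime (ord x)"
    using obtain_prime_order_element[OF assms(1) H(1)] by blast
  then have "ord x = p"
    using ord_dvd_card_subgroup[OF H(1)] H(2) assms(2) primes_dvd_imp_eq by blast
  with x(1) H(1) that show thesis using subgroup.subset by blast
qed

lemma proper_nontrivial_not_prime_order:
  assumes "finite (carrier G)" "proper_nontrivial_subgroups G \<noteq> {}"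
  shows "\<not> prime (order G)"
proof
  assume p: "prime (order G)"
  obtain H where H: "subgroup H G" "H \<noteq> carrier G" "H \<noteq> {\<one>}"
    using assms(2) by (auto simp: proper_nontrivial_subgroups_def)
  have sub: "H \<subseteq> carrier G" using H(1) subgroup.subset by blast
  have "card H dvd order G"
    using card_subgroup_dvd[OF H(1) subgroup_self sub] by (simp add: order_def)
  with p consider "card H = 1" | "card H = order G" by (auto simp: prime_nat_iff)
  then show False
  proof cases
    case 1
    then show False using H(1,3) subgroup.one_closed by (metis card_1_singletonE singletonD)
  next
    case 2
    then show False using H(2) sub assms(1) by (simp add: order_def card_subset_eq)
  qed
qed

section \<open>Domination as a covering problem\<close>

lemma dominating_set_intersection_graph_iff:
  "dominating_set (with_proj (intersection_graph G)) D \<longleftrightarrow>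
     D \<subseteq> proper_nontrivial_subgroups G \<and>
     (\<forall>K \<in> proper_nontrivial_subgroups G - D. \<exists>H \<in> D. K \<inter> H \<noteq> {\<one>})"
  unfolding dominating_set_def
  by (simp add: intersection_graph_def) blast

text \<open>The existence of a vertex enters through elements \<open>x\<close> of prime order: it ensures that \<open>x\<close> does
  not generate \<open>G\<close>, so that the subgroup generated by \<open>x\<close> is itself a vertex to be dominated.\<close>

lemma dominating_set_iff_covers_prime_order:
  assumes fin: "finite (carrier G)" and ne: "proper_nontrivial_subgroups G \<noteq> {}"
  shows "dominating_set (with_proj (intersection_graph G)) D \<longleftrightarrow>
     D \<subseteq> proper_nontrivial_subgroups G \<and> (\<forall>x \<in> carrier G. prime (ord x) \<longrightarrow> x \<in> \<Union>D)"
    (is "?dom \<longleftrightarrow> ?cov")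
proof
  assume dom: ?dom
  then have D: "D \<subseteq> proper_nontrivial_subgroups G"
    and meet: "\<And>K. K \<in> proper_nontrivial_subgroups G - D \<Longrightarrow> \<exists>H \<in> D. K \<inter> H \<noteq> {\<one>}"
    by (auto simp: dominating_set_intersection_graph_iff)
  have "x \<in> \<Union>D" if x: "x \<in> carrier G" "prime (ord x)" for x
  proof -
    define K where "K = generate G {x}"
    have K: "subgroup K G" "card K = ord x" "x \<in> K"
      using x generate_is_subgroup[of "{x}"] generate_pow_card[of x] generate.incl[of x "{x}"]
      by (auto simp: K_def)
    have "K \<noteq> carrier G"
      using K(2) x(2) proper_nontrivial_not_prime_order[OF fin ne] by (auto simp: order_def)
    moreover have "K \<noteq> {\<one>}" using K(2) x(2) by (auto dest: prime_gt_1_nat)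
    ultimately have KV: "K \<in> proper_nontrivial_subgroups G"
      using K(1) by (simp add: proper_nontrivial_subgroups_def)
    show ?thesis
    proof (cases "K \<in> D")
      case True
      with K(3) show ?thesis by blast
    next
      case False
      with meet KV obtain H where H: "H \<in> D" "K \<inter> H \<noteq> {\<one>}" by blast
      then have "subgroup H G" using D by (auto simp: proper_nontrivial_subgroups_def)
      then have KH: "subgroup (K \<inter> H) G" using K(1) subgroups_Inter_pair by blast
      have "card (K \<inter> H) dvd ord x"
        using card_subgroup_dvd[OF KH K(1)] K(2) by simp
      moreover have "card (K \<inter> H) \<noteq> 1"
        using H(2) KH subgroup.one_closed by (metis card_1_singletonE singletonD)
      ultimately have "card (K \<inter> H) = card K"
        using x(2) K(2) by (auto simp: prime_nat_iff)
      moreover have "finite K" using K(1) fin finite_subset subgroup.subset by blast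
      ultimately have "K \<inter> H = K" by (intro card_subset_eq) auto
      with K(3) H(1) show ?thesis by blast
    qed
  qed
  with D show ?cov by blast
next
  assume cov: ?cov
  have "\<exists>H \<in> D. K \<inter> H \<noteq> {\<one>}" if "K \<in> proper_nontrivial_subgroups G" for K
  proof -
    have K: "subgroup K G" "K \<noteq> {\<one>}"
      using that by (auto simp: proper_nontrivial_subgroups_def)
    obtain x where x: "x \<in> K" "prime (ord x)"
      using obtain_prime_order_element[OF fin K] .
    then have "x \<in> carrier G" using K(1) subgroup.subset by blast
    with cov x obtain H where "H \<in> D" "x \<in> H" by blast
    moreover have "x \<noteq> \<one>" using x(2) by auto
    ultimately show ?thesis using x(1) by blast
  qed
  with cov show ?dom by (auto simp: dominating_set_intersection_graph_iff)
qed

lemma group_domination_number_le: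
  assumes "dominating_set (with_proj (intersection_graph G)) D" "finite D"
  shows "group_domination_number G \<le> card D"
  unfolding group_domination_number_def domination_number_def
  using assms by (intro Least_le) blast

lemma finite_proper_nontrivial_subgroups:
  assumes "finite (carrier G)"
  shows "finite (proper_nontrivial_subgroups G)"
proof (rule finite_subset)
  show "proper_nontrivial_subgroups G \<subseteq> Pow (carrier G)"
    by (auto simp: proper_nontrivial_subgroups_def dest: subgroup.subset)
qed (use assms in simp)

text \<open>The set of all vertices is dominating and finite, so the minimum that defines the domination
  number is attained.\<close>

lemma group_domination_number_ge:
  assumes "finite (carrier G)"
    and "\<And>D. dominating_set (with_proj (intersection_graph G)) D \<Longrightarrow> finite D \<Longrightarrow> n \<le> card D"
  shows "n \<le> group_domination_number G"
proof -
  let ?P = "\<lambda>n. \<exists>D. dominating_set (with_proj (intersection_graph G)) D \<and> finite D \<and> card D = n"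
  have "dominating_set (with_proj (intersection_graph G)) (proper_nontrivial_subgroups G)"
    by (simp add: dominating_set_intersection_graph_iff)
  then have "?P (card (proper_nontrivial_subgroups G))"
    using finite_proper_nontrivial_subgroups[OF assms(1)] by blast
  then have "?P (LEAST n. ?P n)" by (rule LeastI)
  with assms(2) show ?thesis
    unfolding group_domination_number_def domination_number_def by metis
qed

lemma obtain_prime_dvd_order:
  assumes "finite (carrier G)" "proper_nontrivial_subgroups G \<noteq> {}"
  obtains p where "prime p" "p dvd order G"
proof -
  obtain H where "subgroup H G" "H \<noteq> {\<one>}"
    using assms(2) by (auto simp: proper_nontrivial_subgroups_def)
  then obtain x where "x \<in> H" "prime (ord x)" "x \<in> carrier G"
    using obtain_prime_order_element[OF assms(1)] subgroup.subset by (metis subsetD)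
  with ord_dvd_group_order that show thesis by blast
qed

lemma group_domination_number_pos:
  assumes "finite (carrier G)" "proper_nontrivial_subgroups G \<noteq> {}"
  shows "1 \<le> group_domination_number G"
proof (rule group_domination_number_ge[OF assms(1)])
  fix D assume "dominating_set (with_proj (intersection_graph G)) D" "finite D"
  with assms(2) show "1 \<le> card D"
    by (cases "D = {}") (auto simp: dominating_set_intersection_graph_iff Suc_le_eq card_gt_0_iff)
qed

section \<open>The exponent and the product of the prime divisors of the order\<close>

lemma ord_dvd_group_exponent: "x \<in> carrier G \<Longrightarrow> ord x dvd group_exponent G"
  by (simp add: group_exponent_def)

lemma group_exponent_dvd_iff:
  "group_exponent G dvd n \<longleftrightarrow> (\<forall>x \<in> carrier G. x [^] n = \<one>)"
  by (auto simp: group_exponent_def Lcm_dvd_iff pow_eq_id)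

lemma group_exponent_pos:
  assumes "finite (carrier G)"
  shows "0 < group_exponent G"
proof -
  have "group_exponent G dvd order G"
    by (simp add: group_exponent_dvd_iff pow_order_eq_1)
  then show ?thesis
    using assms by (metis dvd_0_left_iff gr0I order_gt_0_iff_finite)
qed

lemma finite_prime_divisors_order:
  assumes "finite (carrier G)"
  shows "finite {p. prime p \<and> p dvd order G}"
proof -
  have "order G \<noteq> 0" using assms order_gt_0_iff_finite by (metis less_irrefl)
  then show ?thesis by (intro finite_subset[OF _ finite_divisors_nat[of "order G"]]) auto
qed

lemma prime_dvd_sfp_iff:
  assumes "finite (carrier G)" "prime p"
  shows "p dvd sfp G \<longleftrightarrow> p dvd order G"
  unfolding sfp_def prime_dvd_prod_iff[OF finite_prime_divisors_order[OF assms(1)] assms(2)]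
  using assms(2) primes_dvd_imp_eq by auto

lemma squarefree_sfp: "squarefree (sfp G)"
  unfolding sfp_def by (intro squarefree_prod_distinct_primes) simp

lemma sfp_dvd_group_exponent:
  assumes "finite (carrier G)"
  shows "sfp G dvd group_exponent G"
  unfolding sfp_def
proof (rule prod_distinct_primes_dvd[OF finite_prime_divisors_order[OF assms]])
  fix p assume "p \<in> {p. prime p \<and> p dvd order G}"
  then show "p dvd group_exponent G"
    using Cauchy[OF assms, of p] ord_dvd_group_exponent by auto
qed simp

text \<open>For a prime divisor \<open>p\<close> of the square-free number \<open>ord x = p m\<close>, the factors \<open>p\<close> and \<open>m\<close> are
  coprime. By Bezout, \<open>x\<close> is thus a product of powers of \<open>x\<^sup>p\<close>, of the smaller order \<open>m\<close>, and of
  \<open>x\<^sup>m\<close>, of prime order \<open>p\<close>.\<close>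

lemma mem_subgroup_if_squarefree_order:
  assumes H: "subgroup H G" and prime_ord: "\<And>y. y \<in> carrier G \<Longrightarrow> prime (ord y) \<Longrightarrow> y \<in> H"
    and "x \<in> carrier G" "squarefree (ord x)"
  shows "x \<in> H"
  using assms(3,4)
proof (induction "ord x" arbitrary: x rule: less_induct)
  case less
  note x = less.prems(1)
  show ?case
  proof (cases "ord x = 1")
    case True
    with x have "x = \<one>" using ord_eq_1 by blast
    with H show ?thesis using subgroup.one_closed by blast
  next
    case False
    then obtain p where p: "prime p" "p dvd ord x" using prime_factor_nat by blast
    then obtain m where m: "ord x = p * m" by blast
    have nz: "ord x \<noteq> 0" using less.prems(2) by (metis not_squarefree_0)
    then have "m \<noteq> 0" "p \<noteq> 0" using m by auto
    then have ords: "ord (x [^] p) = m" "ord (x [^] m) = p"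
      using ord_pow[OF x, of p] ord_pow[OF x, of m] m by auto
    have "m < ord x" using m \<open>m \<noteq> 0\<close> prime_gt_1_nat[OF p(1)] by simp
    moreover have "squarefree m" using less.prems(2) m by (metis dvd_triv_right squarefree_mono)
    ultimately have "x [^] p \<in> H" using less.hyps[of "x [^] p"] ords x by simp
    moreover have "x [^] m \<in> H" using prime_ord[of "x [^] m"] ords p(1) x by simp
    ultimately have gH: "(x [^] p) [^] (a::int) \<otimes> (x [^] m) [^] (b::int) \<in> H" for a b
      using H subgroup_int_pow_closed subgroup.m_closed by metis
    have "\<not> p dvd m"
    proof
      assume "p dvd m"
      then have "p ^ 2 dvd ord x" using m by (simp add: power2_eq_square)
      with less.prems(2) p(1) show False by (metis squarefreeD not_prime_unit)
    qed
    then have "coprime p m" using p(1) prime_imp_coprime by blast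
    then have "coprime (int p) (int m)" by simp
    then obtain a b where ab: "a * int p + b * int m = 1"
      by (metis bezout_int coprime_imp_gcd_eq_1)
    have "(x [^] p) [^] a \<otimes> (x [^] m) [^] b = x [^] (int p * a + int m * b)"
      using x by (simp add: int_pow_mult int_pow_pow flip: int_pow_int)
    also have "\<dots> = x" using x ab by (simp add: mult.commute int_pow_1)
    finally show ?thesis using gH by metis
  qed
qed

end

section \<open>Torsion subgroups and the square-free case\<close>

definition torsion :: "('a, 'b) monoid_scheme \<Rightarrow> nat \<Rightarrow> 'a set" where
  "torsion G n = {x \<in> carrier G. x [^]\<^bsub>G\<^esub> n = \<one>\<^bsub>G\<^esub>}"

context comm_group
begin

lemma subgroup_torsion: "subgroup (torsion G n) G"
  by (rule subgroupI) (auto simp: torsion_def nat_pow_inv pow_mult_distrib m_comm)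

lemma mem_torsion_iff: "x \<in> torsion G n \<longleftrightarrow> x \<in> carrier G \<and> ord x dvd n"
  by (auto simp: torsion_def pow_eq_id)

lemma torsion_proper_nontrivial:
  assumes "finite (carrier G)" "prime p" "p dvd order G" "p dvd n" "\<not> group_exponent G dvd n"
  shows "torsion G n \<in> proper_nontrivial_subgroups G"
proof -
  obtain x where x: "x \<in> carrier G" "ord x = p"
    using Cauchy[OF assms(1-3)] .
  then have "x \<in> torsion G n" "x \<noteq> \<one>" using assms(2,4) by (auto simp: mem_torsion_iff)
  moreover have "torsion G n \<noteq> carrier G"
    using assms(5) by (auto simp: group_exponent_dvd_iff torsion_def)
  ultimately show ?thesis
    using subgroup_torsion by (auto simp: proper_nontrivial_subgroups_def)
qed

lemma group_domination_number_eq_1: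
  assumes fin: "finite (carrier G)" and ne: "proper_nontrivial_subgroups G \<noteq> {}"
    and less: "sfp G < group_exponent G"
  shows "group_domination_number G = 1"
proof -
  obtain p where p: "prime p" "p dvd order G" using obtain_prime_dvd_order[OF fin ne] .
  have "sfp G \<noteq> 0" using squarefree_sfp by (metis not_squarefree_0)
  with less have "\<not> group_exponent G dvd sfp G" by (auto dest: dvd_imp_le)
  moreover have "p dvd sfp G" using p prime_dvd_sfp_iff[OF fin] by blast
  ultimately have "torsion G (sfp G) \<in> proper_nontrivial_subgroups G"
    using torsion_proper_nontrivial[OF fin p] by blast
  then have "dominating_set (with_proj (intersection_graph G)) {torsion G (sfp G)}"
    using fin ord_dvd_group_order
    by (auto simp: dominating_set_iff_covers_prime_order[OF fin ne] mem_torsion_iff prime_dvd_sfp_iff)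
  then have "group_domination_number G \<le> 1"
    using group_domination_number_le by fastforce
  with group_domination_number_pos[OF fin ne] show ?thesis by simp
qed

lemma group_domination_number_eq_2:
  assumes fin: "finite (carrier G)" and ne: "proper_nontrivial_subgroups G \<noteq> {}"
    and eq: "sfp G = group_exponent G" and np: "\<not> prime (sfp G)"
  shows "group_domination_number G = 2"
proof (rule antisym)
  obtain p where p: "prime p" "p dvd order G" using obtain_prime_dvd_order[OF fin ne] .
  then have "p dvd sfp G" using prime_dvd_sfp_iff[OF fin] by blast
  then obtain m where m: "sfp G = p * m" by blast
  have nz: "sfp G \<noteq> 0" using squarefree_sfp by (metis not_squarefree_0)
  have "m \<noteq> 1" using m np p(1) by auto
  then obtain q where q: "prime q" "q dvd m" using prime_factor_nat by blast
  then have qG: "q dvd order G" using m prime_dvd_sfp_iff[OF fin q(1)] by simp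
  have "p < sfp G" "m < sfp G"
    using m nz \<open>m \<noteq> 1\<close> prime_gt_1_nat[OF p(1)] by auto
  then have "\<not> group_exponent G dvd p" "\<not> group_exponent G dvd m"
    using eq m nz prime_gt_0_nat[OF p(1)] by (auto dest: dvd_imp_le)
  then have "torsion G p \<in> proper_nontrivial_subgroups G" "torsion G m \<in> proper_nontrivial_subgroups G"
    using torsion_proper_nontrivial[OF fin p] torsion_proper_nontrivial[OF fin q(1) qG q(2)] by auto
  moreover have "x \<in> torsion G p \<union> torsion G m" if "x \<in> carrier G" "prime (ord x)" for x
  proof -
    have "ord x dvd p * m"
      using that(1) ord_dvd_group_exponent eq m by metis
    with that show ?thesis by (auto simp: mem_torsion_iff prime_dvd_mult_iff)
  qed
  ultimately have "dominating_set (with_proj (intersection_graph G)) {torsion G p, torsion G m}"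
    by (auto simp: dominating_set_iff_covers_prime_order[OF fin ne])
  then have "group_domination_number G \<le> card {torsion G p, torsion G m}"
    by (rule group_domination_number_le) simp
  also have "\<dots> \<le> 2" by (simp add: card_insert_if)
  finally show "group_domination_number G \<le> 2" .
next
  show "2 \<le> group_domination_number G"
  proof (rule group_domination_number_ge[OF fin], rule ccontr)
    fix D assume D: "dominating_set (with_proj (intersection_graph G)) D" "finite D" "\<not> 2 \<le> card D"
    have "1 \<le> card D"
      using group_domination_number_le[OF D(1,2)] group_domination_number_pos[OF fin ne] by simp
    with D(3) have "card D = 1" by simp
    then obtain H where DH: "D = {H}" by (rule card_1_singletonE)
    then have H: "subgroup H G" "H \<noteq> carrier G"
      and cov: "\<And>x. x \<in> carrier G \<Longrightarrow> prime (ord x) \<Longrightarrow> x \<in> H"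
      using D(1) by (auto simp: dominating_set_iff_covers_prime_order[OF fin ne]
          proper_nontrivial_subgroups_def)
    have "x \<in> H" if "x \<in> carrier G" for x
    proof (rule mem_subgroup_if_squarefree_order[OF H(1) cov that])
      show "squarefree (ord x)"
        using squarefree_mono[OF ord_dvd_group_exponent[OF that]] squarefree_sfp eq by metis
    qed
    with H show False using subgroup.subset by blast
  qed
qed

end

section \<open>Elementary abelian groups\<close>

text \<open>Apart from the identity, which all of them share, \<open>k\<close> subgroups of index at least \<open>p\<close> cover at
  most \<open>k (|G| / p - 1)\<close> elements. For \<open>k \<le> p\<close> this is at most \<open>|G| - p\<close>, fewer than the \<open>|G| - 1\<close>
  elements to be covered.\<close>

lemma (in group) card_subgroup_cover_gt:
  assumes fin: "finite (carrier G)" and D: "finite D" "D \<noteq> {}"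
    and sub: "\<And>H. H \<in> D \<Longrightarrow> subgroup H G"
    and index: "\<And>H. H \<in> D \<Longrightarrow> p * card H \<le> order G" and p: "2 \<le> p"
    and cov: "carrier G - {\<one>} \<subseteq> \<Union>D"
  shows "p < card D"
proof (rule ccontr)
  assume "\<not> p < card D"
  then have le: "card D \<le> p" by simp
  have finH: "finite H" "\<one> \<in> H" if "H \<in> D" for H
    using finite_subset[OF subgroup.subset[OF sub[OF that]] fin] subgroup.one_closed[OF sub[OF that]] .
  \<comment> \<open>Without this bound the truncated difference \<open>order G - p\<close> below would carry no information.\<close>
  obtain H where "H \<in> D" using D(2) by blast
  then have pN: "p \<le> order G"
    using index[of H] finH[of H] by (metis One_nat_def Suc_leI card_gt_0_iff empty_iff
        le_trans mult.right_neutral mult_le_mono2)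
  have "order G - 1 = card (carrier G - {\<one>})"
    using fin by (simp add: order_def)
  also have "\<dots> \<le> card (\<Union>H\<in>D. H - {\<one>})"
    using cov D(1) finH by (intro card_mono) auto
  also have "\<dots> \<le> (\<Sum>H\<in>D. card (H - {\<one>}))"
    using D(1) by (rule card_UN_le)
  finally have "p * (order G - 1) \<le> (\<Sum>H\<in>D. p * card (H - {\<one>}))"
    by (simp add: sum_distrib_left[symmetric])
  also have "\<dots> \<le> (\<Sum>H\<in>D. order G - p)"
  proof (rule sum_mono)
    fix H assume "H \<in> D"
    then show "p * card (H - {\<one>}) \<le> order G - p"
      using index[of H] finH[of H] by (simp add: diff_mult_distrib2 diff_le_mono)
  qed
  also have "\<dots> \<le> p * (order G - p)" using le by simp
  finally have "order G - 1 \<le> order G - p" using p by simp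
  with pN p show False by simp
qed

context comm_group
begin

lemma subgroup_adjoin:
  assumes "subgroup H G" "x \<in> carrier G"
  shows "subgroup (H <#> generate G {x}) G"
  using assms generate_is_subgroup[of "{x}"] mult_subgroups by simp

lemma adjoinE:
  assumes "finite (carrier G)" "x \<in> carrier G" "g \<in> H <#> generate G {x}"
  obtains h k where "h \<in> H" "g = h \<otimes> x [^] (k::nat)"
  using assms generate_pow_on_finite_carrier[of x] by (auto simp: set_mult_def)

lemma pow_mem_adjoin:
  assumes "finite (carrier G)" "x \<in> carrier G" "h \<in> H"
  shows "h \<otimes> x [^] (k::nat) \<in> H <#> generate G {x}"
  using assms generate_pow_on_finite_carrier[of x] by (auto simp: set_mult_def)

lemma subset_adjoin:
  assumes "finite (carrier G)" "subgroup H G" "x \<in> carrier G"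
  shows "insert x H \<subseteq> H <#> generate G {x}"
proof -
  have "H \<subseteq> carrier G" "\<one> \<in> H"
    using assms(2) subgroup.subset subgroup.one_closed by blast+
  then show ?thesis
    using pow_mem_adjoin[OF assms(1,3), of _ H 0] pow_mem_adjoin[OF assms(1,3), of \<one> H 1] assms(3)
    by (auto simp: subset_iff)
qed

lemma card_adjoin_le:
  assumes "finite (carrier G)" "subgroup H G" "x \<in> carrier G" "x [^] p = \<one>" "0 < p"
  shows "card (H <#> generate G {x}) \<le> card H * p"
proof -
  have fin: "finite H" "finite (generate G {x})"
    using assms(1-3) finite_subset subgroup.subset generate_is_subgroup[of "{x}"] by auto
  have "H <#> generate G {x} = (\<lambda>(h, k). h \<otimes> k) ` (H \<times> generate G {x})"
    by (auto simp: set_mult_def)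
  then have "card (H <#> generate G {x}) \<le> card H * card (generate G {x})"
    using card_image_le[of "H \<times> generate G {x}"] fin by (simp add: card_cartesian_product)
  also have "card (generate G {x}) \<le> p"
    using generate_pow_card[OF assms(3)] assms(3-5) by (simp add: pow_eq_id dvd_imp_le)
  finally show ?thesis by simp
qed

text \<open>Adjoining \<open>x\<close> multiplies the order by at most \<open>p\<close> and makes the subgroup strictly larger; since
  all orders of subgroups are powers of \<open>p\<close>, it multiplies the order by exactly \<open>p\<close>.\<close>

lemma card_adjoin:
  assumes fin: "finite (carrier G)" and p: "prime p" and G: "order G = p ^ n"
    and H: "subgroup H G" "card H = p ^ k" and x: "x \<in> carrier G" "x [^] p = \<one>" "x \<notin> H"
  shows "card (H <#> generate G {x}) = p ^ Suc k"
proof (rule antisym)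
  let ?K = "H <#> generate G {x}"
  show "card ?K \<le> p ^ Suc k"
    using card_adjoin_le[OF fin H(1) x(1,2) prime_gt_0_nat[OF p]] H(2) by (simp add: mult.commute)
  have K: "subgroup ?K G" using subgroup_adjoin[OF H(1) x(1)] .
  then have "finite ?K" using fin finite_subset subgroup.subset by blast
  moreover have "H \<subset> ?K" using subset_adjoin[OF fin H(1) x(1)] x(3) by blast
  ultimately have less: "p ^ k < card ?K" using H(2) psubset_card_mono by metis
  have "card ?K dvd p ^ n"
    using card_subgroup_dvd[OF K subgroup_self subgroup.subset[OF K]] G by (simp add: order_def)
  then obtain j where j: "card ?K = p ^ j" using p divides_primepow_nat by blast
  with less have "k < j" using power_less_imp_less_exp prime_gt_1_nat[OF p] by metis
  with j show "p ^ Suc k \<le> card ?K"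
    using prime_gt_0_nat[OF p] by (metis Suc_leI power_increasing Suc_leI One_nat_def)
qed

text \<open>Take a subgroup \<open>U\<close> of index \<open>p\<^sup>2\<close> and \<open>x\<close>, \<open>y\<close> that together with \<open>U\<close> generate \<open>G\<close>. The
  hyperplanes through \<open>U\<close> correspond to the points of the projective line over the field with \<open>p\<close>
  elements: they are \<open>U\<langle>x\<rangle>\<close>, the point at infinity, and \<open>U\<langle>y x\<^sup>i\<rangle>\<close> for \<open>i < p\<close>. An element
  \<open>u x\<^sup>a y\<^sup>b\<close> lies in the first if \<open>p\<close> divides \<open>b\<close>, and otherwise in the one with \<open>i = a / b\<close>
  modulo \<open>p\<close>.\<close>

lemma elementary_abelian_cover:
  assumes fin: "finite (carrier G)" and p: "prime p" and G: "order G = p ^ (n + 2)"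
    and exp: "\<And>x. x \<in> carrier G \<Longrightarrow> x [^] p = \<one>"
  obtains D where "D \<subseteq> proper_nontrivial_subgroups G" "carrier G \<subseteq> \<Union>D" "finite D" "card D \<le> p + 1"
proof -
  let ?adj = "\<lambda>H x. H <#> generate G {x}"
  have p1: "1 < p" using prime_gt_1_nat[OF p] .
  obtain U where U: "subgroup U G" "card U = p ^ n"
    using sylow_thm[OF p is_group _ fin, of n "p ^ 2"] G by (auto simp only: power_add)
  have subU: "U \<subseteq> carrier G" using U(1) subgroup.subset by blast
  have "U \<noteq> carrier G" using U(2) G p1 by (auto simp: order_def)
  then obtain x where x: "x \<in> carrier G" "x \<notin> U" using subU by blast
  define M where "M = ?adj U x"
  have M: "subgroup M G" "card M = p ^ Suc n"
    using subgroup_adjoin[OF U(1) x(1)] card_adjoin[OF fin p G U x(1) exp[OF x(1)] x(2)]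
    by (auto simp: M_def)
  have subM: "M \<subseteq> carrier G" using M(1) subgroup.subset by blast
  have "M \<noteq> carrier G" using M(2) G p1 by (auto simp: order_def)
  then obtain y where y: "y \<in> carrier G" "y \<notin> M" using subM by blast
  have "?adj M y = carrier G"
  proof (rule card_subset_eq[OF fin])
    show "?adj M y \<subseteq> carrier G" using subgroup_adjoin[OF M(1) y(1)] subgroup.subset by blast
    show "card (?adj M y) = card (carrier G)"
      using card_adjoin[OF fin p G M y(1) exp[OF y(1)] y(2)] G by (simp add: order_def)
  qed
  have adj: "?adj U z \<in> proper_nontrivial_subgroups G" if z: "z \<in> carrier G" "z \<notin> U" for z
  proof -
    have "card (?adj U z) = p ^ Suc n"
      using card_adjoin[OF fin p G U z(1) exp[OF z(1)] z(2)] .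
    then have "?adj U z \<noteq> carrier G" using G p1 by (auto simp: order_def)
    moreover have "?adj U z \<noteq> {\<one>}"
      using subset_adjoin[OF fin U(1) z(1)] z(2) subgroup.one_closed[OF U(1)] by auto
    ultimately show ?thesis
      using subgroup_adjoin[OF U(1) z(1)] by (simp add: proper_nontrivial_subgroups_def)
  qed
  define z where "z i = y \<otimes> x [^] i" for i :: nat
  define D where "D = insert M ((\<lambda>i. ?adj U (z i)) ` {..<p})"
  have z: "z i \<in> carrier G" "z i \<notin> U" for i
  proof -
    show "z i \<in> carrier G" using x y by (simp add: z_def)
    have "x [^] i \<in> M"
      using subset_adjoin[OF fin U(1) x(1)] nat_pow_mem_subgroup[OF M(1)] by (simp add: M_def)
    then have "inv (x [^] i) \<in> M" by (rule subgroup.m_inv_closed[OF M(1)])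
    moreover have "y = z i \<otimes> inv (x [^] i)" using x y by (simp add: z_def m_assoc)
    moreover have "U \<subseteq> M" using subset_adjoin[OF fin U(1) x(1)] by (simp add: M_def)
    ultimately show "z i \<notin> U" using y(2) subgroup.m_closed[OF M(1)] by (metis subsetD)
  qed
  show thesis
  proof
    show "D \<subseteq> proper_nontrivial_subgroups G"
      using adj[OF x] adj[OF z] by (auto simp: D_def M_def)
    show "finite D" by (simp add: D_def)
    have "card D \<le> Suc (card ((\<lambda>i. ?adj U (z i)) ` {..<p}))"
      unfolding D_def by (rule card_insert_le_m1) auto
    also have "\<dots> \<le> Suc p" using card_image_le[of "{..<p}" "\<lambda>i. ?adj U (z i)"] by simp
    finally show "card D \<le> p + 1" by simp
    show "carrier G \<subseteq> \<Union>D"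
    proof
      fix g assume "g \<in> carrier G"
      then obtain m b where m: "m \<in> M" and g: "g = m \<otimes> y [^] (b::nat)"
        using \<open>?adj M y = carrier G\<close> adjoinE[OF fin y(1)] by metis
      obtain u a where u: "u \<in> U" and ma: "m = u \<otimes> x [^] (a::nat)"
        using m adjoinE[OF fin x(1)] unfolding M_def by metis
      show "g \<in> \<Union>D"
      proof (cases "p dvd b")
        case True
        then have "y [^] b = \<one>" using y exp by (auto simp: nat_pow_pow[symmetric])
        with g m subM have "g \<in> M" by auto
        then show ?thesis by (simp add: D_def)
      next
        case False
        then have "coprime b p" using p prime_imp_coprime coprime_commute by blast
        then obtain c where c: "[b * c = 1] (mod p)" using cong_solve_coprime_nat by auto
        \<comment> \<open>The quotient \<open>a / b\<close> modulo \<open>p\<close>, as \<open>c\<close> is the inverse of \<open>b\<close>.\<close>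
        define i where "i = (c * a) mod p"
        have "[i * b = c * a * b] (mod p)"
          by (simp add: i_def cong_def mod_mult_left_eq)
        also have "c * a * b = b * c * a" by simp
        also have "[b * c * a = 1 * a] (mod p)" using c by (rule cong_scalar_right)
        finally have "[i * b = a] (mod p)" by simp
        then have "x [^] (i * b) = x [^] a"
          using pow_cong[OF x(1) exp[OF x(1)]] by blast
        then have "z i [^] b = x [^] a \<otimes> y [^] b"
          using x y by (simp add: z_def pow_mult_distrib m_comm nat_pow_pow)
        then have "g = u \<otimes> z i [^] b"
          using g ma x y u subU by (simp add: m_assoc subsetD)
        then have "g \<in> ?adj U (z i)" using pow_mem_adjoin[OF fin z(1) u] by simp
        moreover have "i < p" using p1 by (simp add: i_def)
        ultimately show ?thesis by (auto simp: D_def)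
      qed
    qed
  qed
qed

lemma group_domination_number_eq_Suc_prime:
  assumes fin: "finite (carrier G)" and ne: "proper_nontrivial_subgroups G \<noteq> {}"
    and p: "prime p" and sfp: "sfp G = p" and exp: "group_exponent G = p"
  shows "group_domination_number G = p + 1"
proof -
  have pow: "x [^] p = \<one>" if "x \<in> carrier G" for x
    using that exp group_exponent_dvd_iff[of p] by simp
  have ord: "ord x = p" if "x \<in> carrier G" "x \<noteq> \<one>" for x
    using that p exp ord_dvd_group_exponent[of x] ord_eq_1[of x] by (auto simp: prime_nat_iff)
  have "order G \<noteq> 0" using fin order_gt_0_iff_finite by (metis less_irrefl)
  then obtain k where k: "order G = p ^ k"
    using prime_power_if_unique_prime_divisor[OF _ p, of "order G"] prime_dvd_sfp_iff[OF fin] sfp p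
    by (metis primes_dvd_imp_eq)
  \<comment> \<open>A proper nontrivial subgroup forces dimension at least two.\<close>
  have "k \<noteq> 0" using k obtain_prime_dvd_order[OF fin ne] by (metis nat_dvd_1_iff_1 not_prime_1 power_0)
  moreover have "k \<noteq> 1" using k p proper_nontrivial_not_prime_order[OF fin ne] by auto
  ultimately obtain n where n: "k = n + 2" by (metis One_nat_def Suc_1 add_2_eq_Suc' not0_implies_Suc)
  show ?thesis
  proof (rule antisym)
    obtain D where D: "D \<subseteq> proper_nontrivial_subgroups G" "carrier G \<subseteq> \<Union>D" "finite D" "card D \<le> p + 1"
      using elementary_abelian_cover[OF fin p _ pow] k n by metis
    then have "dominating_set (with_proj (intersection_graph G)) D"
      by (auto simp: dominating_set_iff_covers_prime_order[OF fin ne])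
    then show "group_domination_number G \<le> p + 1"
      using group_domination_number_le D(3,4) le_trans by blast
  next
    show "p + 1 \<le> group_domination_number G"
    proof (rule group_domination_number_ge[OF fin])
      fix D assume D: "dominating_set (with_proj (intersection_graph G)) D" "finite D"
      then have DV: "D \<subseteq> proper_nontrivial_subgroups G"
        and cov: "\<And>x. x \<in> carrier G \<Longrightarrow> prime (ord x) \<Longrightarrow> x \<in> \<Union>D"
        by (auto simp: dominating_set_iff_covers_prime_order[OF fin ne])
      have "p < card D"
      proof (rule card_subgroup_cover_gt[OF fin D(2)])
        show "D \<noteq> {}"
          using group_domination_number_pos[OF fin ne] group_domination_number_le[OF D] by auto
        show "carrier G - {\<one>} \<subseteq> \<Union>D"
        proof
          fix x assume "x \<in> carrier G - {\<one>}"
          then show "x \<in> \<Union>D" using cov[of x] ord[of x] p by simp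
        qed
        show "2 \<le> p" using prime_ge_2_nat[OF p] .
        fix H assume "H \<in> D"
        then have H: "subgroup H G" "H \<noteq> carrier G"
          using DV by (auto simp: proper_nontrivial_subgroups_def)
        then show "subgroup H G" by blast
        have sub: "H \<subseteq> carrier G" using H(1) subgroup.subset by blast
        have "card H dvd p ^ k"
          using card_subgroup_dvd[OF H(1) subgroup_self sub] k by (simp add: order_def)
        then obtain j where j: "card H = p ^ j" using p divides_primepow_nat by blast
        have "card H < order G"
          using H(2) sub fin by (metis order_def psubsetI psubset_card_mono)
        then have "j < k" using j k prime_gt_1_nat[OF p] by simp
        then have "p ^ Suc j \<le> p ^ k"
          using prime_gt_0_nat[OF p] by (intro power_increasing) auto
        then show "p * card H \<le> order G" using j k by simp
      qed
      then show "p + 1 \<le> card D" by simp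
    qed
  qed
qed

end

section \<open>The domination number of a finite abelian group\<close>

theorem theorem3p1:
  fixes G :: "('a, 'b) monoid_scheme"
  assumes "comm_group G"
    and "finite (carrier G)"
    and "proper_nontrivial_subgroups G \<noteq> {}"
  shows "(group_domination_number G = 1 \<longleftrightarrow> sfp G < group_exponent G) \<and>
    (group_domination_number G = 2 \<longleftrightarrow> sfp G = group_exponent G \<and> \<not> prime (sfp G)) \<and>
    (\<forall>p::nat. prime p \<longrightarrow>
      (group_domination_number G = p + 1 \<longleftrightarrow> p = sfp G \<and> sfp G = group_exponent G))"
proof -
  interpret comm_group G by fact
  have "sfp G \<le> group_exponent G"
    using sfp_dvd_group_exponent group_exponent_pos assms(2) dvd_imp_le by blast
  then consider (less) "sfp G < group_exponent G"
    | (composite) "sfp G = group_exponent G" "\<not> prime (sfp G)"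
    | (prime) "sfp G = group_exponent G" "prime (sfp G)"
    by linarith
  then show ?thesis
  proof cases
    case less
    with group_domination_number_eq_1[OF assms(2,3)] show ?thesis by (auto dest: prime_gt_1_nat)
  next
    case composite
    with group_domination_number_eq_2[OF assms(2,3)] show ?thesis by (auto dest: prime_gt_1_nat)
  next
    case prime
    have "group_domination_number G = sfp G + 1"
      using group_domination_number_eq_Suc_prime[OF assms(2,3) prime(2) refl prime(1)[symmetric]] .
    moreover have "2 \<le> sfp G" using prime(2) by (rule prime_ge_2_nat)
    ultimately show ?thesis
      using prime(2) unfolding prime(1)[symmetric] by auto
  qed
qed

end
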